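(* Let $\alpha\ne0$ be a simple root of $f(x)=0$ (so $f'(\alpha)\neq 0$) with $f''(\alpha)=0$, and let $q\neq 0$, $q\ne1$ be a real number. Then $$|\mu(\alpha)|=0\le|\mu_q(\alpha^q)| ,$$ and this is equivalent to the statement that the convergence to $\alpha$ of Newton's method is equal to or faster than that of the $q$th power of the binomial expansion of Newton's method (of any truncation order $N\ge1$).
   Context: $f$ is a real function of a real variable, $C^2$ near $\alpha$. Put $g(t)=f(t^{1/q})$, so $g(x^q)=f(x)$. The curvatures are $\mu(x)=\frac{f''(x)}{(1+f'(x)^2)^{3/2}}$ and $\mu_q(t)=\frac{g''(t)}{(1+g'(t)^2)^{3/2}}$. Newton's method is $x_{k+1}=x_k-\frac{f(x_k)}{f'(x_k)}$. For an integer $N\ge1$, the $q$th power of the binomial expansion of Newton's method of truncation order $N$ is the recurrence $$x_{k+1}^q=\sum_{i=0}^{N}\binom{q}{i}x_k^{q-i}\left[-\frac{f(x_k)}{f'(x_k)}\right]^i,\qquad \binom{q}{i}=\frac{q(q-1)\cdots(q-i+1)}{i!}.$$ Real powers occurring are assumed to be defined as real numbers (e.g. positive base), and $t\mapsto t^{1/q}$ is the inverse of $x\mapsto x^q$ near $\alpha$. If a method has the form $x_{k+1}=\varphi(x_k)$, its asymptotic error constant at $\alpha$ is $\lim_{x\to\alpha}|\varphi(x)-\alpha|/(x-\alpha)^2$. "The convergence of method A to $\alpha$ is equal to or faster than that of method B" means that both methods converge to $\alpha$ from every initial value sufficiently close to $\alpha$, and the asymptotic error constant of A is at most that of B. *)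

theory Defs
  imports "HOL-Analysis.Analysis"
begin

definition C2_near :: "(real \<Rightarrow> real) \<Rightarrow> real \<Rightarrow> bool" where
  "C2_near f \<alpha> \<longleftrightarrow>
     (\<exists>U. open U \<and> \<alpha> \<in> U \<and>
          (\<forall>x\<in>U. f field_differentiable (at x) \<and> deriv f field_differentiable (at x)) \<and>
          continuous_on U (deriv (deriv f)))"

definition curvature :: "(real \<Rightarrow> real) \<Rightarrow> real \<Rightarrow> real" where
  "curvature h x = deriv (deriv h) x / (1 + (deriv h x)\<^sup>2) powr (3 / 2)"

text \<open>
  Real powers with real exponent. On a negative base, \<^term>\<open>x powr q\<close> is not the intended
  power. There a real value exists precisely when the exponent is a fraction \<open>p / r\<close> with \<open>r\<close> odd,
  and it is the \<open>p\<close>-th power of the real \<open>r\<close>-th root; by \<open>real_pow_fraction\<close> below this does not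
  depend on the fraction chosen.
\<close>

definition real_pow_defined :: "real \<Rightarrow> real \<Rightarrow> bool" where
  "real_pow_defined x q \<longleftrightarrow>
     0 < x \<or> x < 0 \<and> (\<exists>(p::int) (r::nat). odd r \<and> q = of_int p / real r)"

definition real_pow :: "real \<Rightarrow> real \<Rightarrow> real" where
  "real_pow x q =
     (if 0 < x then x powr q
      else (THE y. \<exists>(p::int) (r::nat). odd r \<and> q = of_int p / real r \<and> y = root r x powi p))"

text \<open>
  The inverse of \<open>x \<mapsto> x^q\<close> near \<open>\<alpha>\<close>, written \<open>t \<mapsto> t^(1/q)\<close>: the branch with values
  on the same side of 0 as \<open>\<alpha>\<close>. For instance it is \<open>t \<mapsto> - sqrt t\<close> if \<open>q = 2\<close> and \<open>\<alpha> < 0\<close>.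
\<close>

definition pow_inverse :: "real \<Rightarrow> real \<Rightarrow> real \<Rightarrow> real" where
  "pow_inverse \<alpha> q = the_inv_into {x. 0 < \<alpha> * x} (\<lambda>x. real_pow x q)"

definition pow_transform :: "(real \<Rightarrow> real) \<Rightarrow> real \<Rightarrow> real \<Rightarrow> real \<Rightarrow> real" where
  "pow_transform f \<alpha> q t = f (pow_inverse \<alpha> q t)"

definition newton_map :: "(real \<Rightarrow> real) \<Rightarrow> real \<Rightarrow> real" where
  "newton_map f x = x - f x / deriv f x"

text \<open>
  The recurrence prescribes the \<open>q\<close>-th power of the next iterate; the iterate itself is the
  \<open>q\<close>-th root on the branch at \<open>\<alpha>\<close>.
\<close>

definition binomial_newton_map ::
  "(real \<Rightarrow> real) \<Rightarrow> real \<Rightarrow> real \<Rightarrow> nat \<Rightarrow> real \<Rightarrow> real" where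
  "binomial_newton_map f \<alpha> q N x =
     pow_inverse \<alpha> q
       (\<Sum>i=0..N. (q gchoose i) * real_pow x (q - real i) * (- (f x / deriv f x)) ^ i)"

definition locally_convergent :: "(real \<Rightarrow> real) \<Rightarrow> real \<Rightarrow> bool" where
  "locally_convergent \<phi> \<alpha> \<longleftrightarrow> (\<forall>\<^sub>F x0 in nhds \<alpha>. (\<lambda>k. (\<phi> ^^ k) x0) \<longlonglongrightarrow> \<alpha>)"

definition has_asymptotic_error_constant :: "(real \<Rightarrow> real) \<Rightarrow> real \<Rightarrow> real \<Rightarrow> bool" where
  "has_asymptotic_error_constant \<phi> \<alpha> C \<longleftrightarrow> ((\<lambda>x. \<bar>\<phi> x - \<alpha>\<bar> / (x - \<alpha>)\<^sup>2) \<longlongrightarrow> C) (at \<alpha>)"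

definition converges_equal_or_faster ::
  "(real \<Rightarrow> real) \<Rightarrow> (real \<Rightarrow> real) \<Rightarrow> real \<Rightarrow> bool" where
  "converges_equal_or_faster \<phi> \<psi> \<alpha> \<longleftrightarrow>
     locally_convergent \<phi> \<alpha> \<and> locally_convergent \<psi> \<alpha> \<and>
     (\<exists>A B. has_asymptotic_error_constant \<phi> \<alpha> A \<and>
            has_asymptotic_error_constant \<psi> \<alpha> B \<and> A \<le> B)"

lemma root_powi_unique:
  fixes x :: real and p p' :: int and r r' :: nat
  assumes "odd r" "odd r'" "of_int p / real r = of_int p' / real r'"
  shows "root r x powi p = root r' x powi p'"
proof -
  have pos: "r > 0" "r' > 0" using assms by (auto intro: odd_pos)
  have "real_of_int (p * int r') = real_of_int (p' * int r)"
    using assms(3) pos by (simp add: field_simps)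
  then have e: "p * int r' = p' * int r" by linarith
  have a: "(root s x powi m) ^ (s * s') = x powi (m * int s')"
    if "odd s" for s s' :: nat and m :: int
  proof -
    have "(root s x powi m) ^ (s * s') = root s x powi (int s * (m * int s'))"
      by (simp add: power_int_mult power_int_power mult_ac flip: power_int_of_nat)
    also have "\<dots> = (root s x ^ s) powi (m * int s')"
      by (simp add: power_int_mult)
    finally show ?thesis using that by (simp add: odd_real_root_pow)
  qed
  have "(root r x powi p) ^ (r * r') = (root r' x powi p') ^ (r * r')"
    using a[OF assms(1), of p r'] a[OF assms(2), of p' r] e by (simp add: mult.commute)
  moreover have "odd (r * r')" using assms by simp
  ultimately show ?thesis
    by (metis odd_real_root_power_cancel)
qed

lemma real_pow_fraction:
  fixes p :: int and r :: nat
  assumes "odd r" "x \<noteq> 0"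
  shows "real_pow x (of_int p / real r) = root r x powi p"
proof (cases "0 < x")
  case True
  have "r > 0" using assms by (auto intro: odd_pos)
  then have "root r x powi p = (x powr (1 / real r)) powr of_int p"
    using True by (simp add: root_powr_inverse powr_real_of_int' flip: inverse_eq_divide)
  then show ?thesis using True by (simp add: real_pow_def powr_powr)
next
  case False
  then show ?thesis unfolding real_pow_def
    using assms(1) by (auto intro!: the_equality root_powi_unique)
qed

lemma abs_real_pow:
  assumes "real_pow_defined x q"
  shows "\<bar>real_pow x q\<bar> = \<bar>x\<bar> powr q"
proof (cases "0 < x")
  case True
  then show ?thesis by (simp add: real_pow_def)
next
  case False
  then obtain p :: int and r :: nat where pr: "odd r" "q = of_int p / real r" and x: "x < 0"
    using assms by (auto simp: real_pow_defined_def)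
  have "\<bar>real_pow x q\<bar> = \<bar>root r x powi p\<bar>"
    using real_pow_fraction[OF pr(1), of x p] pr x by simp
  also have "\<dots> = root r \<bar>x\<bar> powi p"
    using pr by (simp add: power_int_abs real_root_abs odd_pos)
  also have "\<dots> = real_pow \<bar>x\<bar> q"
    using real_pow_fraction[OF pr(1), of "\<bar>x\<bar>" p] pr x by simp
  also have "\<dots> = \<bar>x\<bar> powr q" using x by (simp add: real_pow_def)
  finally show ?thesis .
qed

lemma pow_inverse_real_pow:
  assumes "real_pow_defined \<alpha> q" "q \<noteq> 0" "0 < \<alpha> * x"
  shows "pow_inverse \<alpha> q (real_pow x q) = x"
proof -
  have d: "real_pow_defined y q" if "0 < \<alpha> * y" for y
    using that assms(1) by (auto simp: real_pow_defined_def zero_less_mult_iff)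
  have "inj_on (\<lambda>x. real_pow x q) {x. 0 < \<alpha> * x}"
  proof (rule inj_onI, clarsimp)
    fix y z assume yz: "0 < \<alpha> * y" "0 < \<alpha> * z" "real_pow y q = real_pow z q"
    then have "\<bar>y\<bar> powr q = \<bar>z\<bar> powr q" using abs_real_pow d by metis
    then have "(\<bar>y\<bar> powr q) powr (1 / q) = (\<bar>z\<bar> powr q) powr (1 / q)" by simp
    then have "\<bar>y\<bar> = \<bar>z\<bar>" using assms(2) by (simp add: powr_powr)
    then show "y = z" using yz by (auto simp: zero_less_mult_iff abs_if split: if_splits)
  qed
  then show ?thesis unfolding pow_inverse_def
    using assms(3) by (intro the_inv_into_f_f) auto
qed

lemma pow_transform_real_pow:
  assumes "real_pow_defined \<alpha> q" "q \<noteq> 0" "0 < \<alpha> * x"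
  shows "pow_transform f \<alpha> q (real_pow x q) = f x"
  using assms by (simp add: pow_transform_def pow_inverse_real_pow)

lemma pow_inverse_pos:
  assumes "0 < \<alpha>" "q \<noteq> 0" "0 < t"
  shows "pow_inverse \<alpha> q t = t powr (1 / q)"
proof -
  have "real_pow (t powr (1 / q)) q = t"
    using assms by (simp add: real_pow_def powr_powr)
  then show ?thesis
    using pow_inverse_real_pow[of \<alpha> q "t powr (1 / q)"] assms
    by (simp add: real_pow_defined_def)
qed

end

theory Submission
  imports Defs
begin

text \<open>
  The left-hand side of the equivalence always holds, so the content is that its right-hand side
  does too. Write \<open>u = f x / f' x\<close>. Factoring \<open>x^q\<close> out of the truncated binomial sum turns the
  recurrence into \<open>\<psi> x = x G (- u / x)\<close>, where \<open>G z\<close> is the \<open>1/q\<close>-th power of the truncated binomial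
  series of \<open>(1 + z)^q\<close>. Since \<open>N \<ge> 1\<close>, \<open>G z = 1 + z + c z^2 + o(z^2)\<close>, hence
  \<open>\<psi> x - \<alpha> = (x - u - \<alpha>) + c u^2 / x + o(u^2)\<close>: the error of Newton's method plus a term whose
  quotient by \<open>(x - \<alpha>)^2\<close> tends to \<open>c / \<alpha>\<close>. So the error constant of \<open>\<psi>\<close> exists, whereas that of
  Newton's method is \<open>\<bar>f'' \<alpha> / (2 f' \<alpha>)\<bar> = 0\<close>.
\<close>

section \<open>Taylor remainders and quadratic convergence of iterations\<close>

lemma second_order_remainder_tendsto:
  fixes F F' :: "real \<Rightarrow> real"
  assumes F: "\<forall>\<^sub>F x in nhds a. (F has_real_derivative F' x) (at x)"
    and F': "(F' has_real_derivative D) (at a)"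
  shows "((\<lambda>x. (F x - F a - F' a * (x - a)) / (x - a)\<^sup>2) \<longlongrightarrow> D / 2) (at a)"
proof (rule lhopital[where f' = "\<lambda>x. F' x - F' a" and g' = "\<lambda>x. 2 * (x - a)"])
  have "(F has_real_derivative F' a) (at a)"
    using F by (rule eventually_nhds_x_imp_x)
  then have "isCont F a" by (rule DERIV_isCont)
  then have "((\<lambda>x. F x - F a - F' a * (x - a)) \<longlongrightarrow> F a - F a - F' a * (a - a)) (at a)"
    by (intro tendsto_intros) (simp add: isCont_def)
  then show "((\<lambda>x. F x - F a - F' a * (x - a)) \<longlongrightarrow> 0) (at a)" by simp
  have "((\<lambda>x. (x - a)\<^sup>2) \<longlongrightarrow> (a - a)\<^sup>2) (at a)"
    by (intro tendsto_intros)
  then show "((\<lambda>x. (x - a)\<^sup>2) \<longlongrightarrow> 0) (at a)" by simp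
  show "\<forall>\<^sub>F x in at a. (x - a)\<^sup>2 \<noteq> 0" "\<forall>\<^sub>F x in at a. 2 * (x - a) \<noteq> 0"
    by (simp_all add: eventually_at_filter)
  show "\<forall>\<^sub>F x in at a. ((\<lambda>x. F x - F a - F' a * (x - a)) has_real_derivative F' x - F' a) (at x)"
    using filter_leD[OF at_within_le_nhds F]
    by eventually_elim (auto intro!: derivative_eq_intros)
  show "\<forall>\<^sub>F x in at a. ((\<lambda>x. (x - a)\<^sup>2) has_real_derivative 2 * (x - a)) (at x)"
    by (intro always_eventually allI) (auto intro!: derivative_eq_intros)
  \<comment> \<open>A single use of l'Hopital suffices: the quotient of the derivatives is half the
    difference quotient of \<open>F'\<close>, so differentiability of \<open>F'\<close> at the one
    point \<open>a\<close> is enough.\<close>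
  have "((\<lambda>x. (F' x - F' a) / (x - a) / 2) \<longlongrightarrow> D / 2) (at a)"
    using F' by (intro tendsto_intros) (simp_all add: has_field_derivative_iff)
  then show "((\<lambda>x. (F' x - F' a) / (2 * (x - a))) \<longlongrightarrow> D / 2) (at a)"
    by (simp add: mult.commute)
qed

text \<open>A finite error constant makes the error quotient times
  \<open>\<bar>x - \<alpha>\<bar>\<close> tend to 0, so near \<alpha> each step at least halves the
  error. The fixed point covers an iterate that hits \<alpha>, where the limit says nothing.\<close>

lemma locally_convergent_if_asymptotic_error_constant:
  assumes fixpoint: "\<phi> \<alpha> = \<alpha>" and C: "has_asymptotic_error_constant \<phi> \<alpha> C"
  shows "locally_convergent \<phi> \<alpha>"
proof -
  have "((\<lambda>x. \<bar>\<phi> x - \<alpha>\<bar> / (x - \<alpha>)\<^sup>2 * \<bar>x - \<alpha>\<bar>) \<longlongrightarrow> C * \<bar>\<alpha> - \<alpha>\<bar>) (at \<alpha>)"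
    using C unfolding has_asymptotic_error_constant_def by (intro tendsto_intros)
  then have "\<forall>\<^sub>F x in at \<alpha>. \<bar>\<phi> x - \<alpha>\<bar> / (x - \<alpha>)\<^sup>2 * \<bar>x - \<alpha>\<bar> < 1 / 2"
    by (rule order_tendstoD) simp
  then obtain d where "d > 0"
    and d: "\<And>x. x \<noteq> \<alpha> \<Longrightarrow> \<bar>x - \<alpha>\<bar> < d \<Longrightarrow> \<bar>\<phi> x - \<alpha>\<bar> / (x - \<alpha>)\<^sup>2 * \<bar>x - \<alpha>\<bar> < 1 / 2"
    by (auto simp: eventually_at dist_real_def)
  have step: "\<bar>\<phi> x - \<alpha>\<bar> \<le> \<bar>x - \<alpha>\<bar> / 2" if "\<bar>x - \<alpha>\<bar> < d" for x
  proof (cases "x = \<alpha>")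
    case False
    have sq: "(x - \<alpha>)\<^sup>2 = \<bar>x - \<alpha>\<bar> * \<bar>x - \<alpha>\<bar>" by (simp add: power2_eq_square)
    have "\<bar>\<phi> x - \<alpha>\<bar> / \<bar>x - \<alpha>\<bar> < 1 / 2"
      using d[OF False that] False unfolding sq by (simp del: abs_mult_self_eq)
    then show ?thesis using False by (simp add: pos_divide_less_eq)
  qed (use fixpoint in simp)
  show ?thesis unfolding locally_convergent_def
  proof (rule eventually_mono)
    show "\<forall>\<^sub>F x in nhds \<alpha>. \<bar>x - \<alpha>\<bar> < d"
      using \<open>d > 0\<close> by (auto simp: eventually_nhds_metric dist_real_def)
    fix x assume x: "\<bar>x - \<alpha>\<bar> < d"
    have bound: "\<bar>(\<phi> ^^ k) x - \<alpha>\<bar> \<le> \<bar>x - \<alpha>\<bar> * (1 / 2) ^ k" for k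
    proof (induction k)
      case (Suc k)
      \<comment> \<open>This keeps the \<open>k\<close>-th iterate within distance \<open>d\<close>
        of \<alpha>, so that \<open>step\<close> applies again.\<close>
      have "\<bar>x - \<alpha>\<bar> * (1 / 2) ^ k \<le> \<bar>x - \<alpha>\<bar>"
        by (simp add: mult_left_le power_le_one)
      then show ?case using step[of "(\<phi> ^^ k) x"] Suc x by simp
    qed simp
    have "(\<lambda>k. \<bar>x - \<alpha>\<bar> * (1 / 2) ^ k) \<longlonglongrightarrow> 0"
      by (intro tendsto_mult_right_zero LIMSEQ_power_zero) simp
    then have "(\<lambda>k. (\<phi> ^^ k) x - \<alpha>) \<longlonglongrightarrow> 0"
      by (rule Lim_null_comparison[rotated]) (simp add: bound)
    then show "(\<lambda>k. (\<phi> ^^ k) x) \<longlonglongrightarrow> \<alpha>"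
      by (simp add: LIM_zero_iff)
  qed
qed

section \<open>Real powers on the side of 0 that contains \<alpha>\<close>

lemma eventually_same_sign:
  fixes \<alpha> :: real
  assumes "\<alpha> \<noteq> 0"
  shows "\<forall>\<^sub>F x in at \<alpha>. 0 < \<alpha> * x"
proof (rule order_tendstoD)
  show "((\<lambda>x. \<alpha> * x) \<longlongrightarrow> \<alpha> * \<alpha>) (at \<alpha>)" by (intro tendsto_intros)
  show "0 < \<alpha> * \<alpha>" using assms by (metis not_real_square_gt_zero)
qed

lemma real_pow_defined_same_sign:
  assumes "real_pow_defined \<alpha> q" "0 < \<alpha> * x"
  shows "real_pow_defined x q"
  using assms by (auto simp: real_pow_defined_def zero_less_mult_iff)

text \<open>For negative \<open>x\<close>, both powers are written with the same fraction
  \<open>p / r\<close>; odd roots and integer powers are multiplicative, and on the positive factor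
  this agrees with \<open>powr\<close>.\<close>

lemma real_pow_mult_pos:
  assumes "real_pow_defined x q" "0 < v"
  shows "real_pow (x * v) q = real_pow x q * v powr q"
proof (cases "0 < x")
  case True
  then show ?thesis using assms by (simp add: real_pow_def powr_mult)
next
  case False
  then obtain p :: int and r :: nat where pr: "odd r" "q = of_int p / real r" and x: "x < 0"
    using assms by (auto simp: real_pow_defined_def)
  have v: "v powr q = real_pow v q" using assms by (simp add: real_pow_def)
  show ?thesis
    using pr x assms(2) unfolding v
    by (simp add: real_pow_fraction real_root_mult power_int_mult_distrib)
qed

lemma real_pow_diff_nat:
  assumes "real_pow_defined x q"
  shows "real_pow x (q - real i) = real_pow x q / x ^ i"
proof (cases "0 < x")
  case True
  then show ?thesis by (simp add: real_pow_def powr_diff powr_realpow)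
next
  case False
  then obtain p :: int and r :: nat where pr: "odd r" "q = of_int p / real r" and x: "x < 0"
    using assms by (auto simp: real_pow_defined_def)
  have "r > 0" using pr by (auto intro: odd_pos)
  \<comment> \<open>Keeping the odd denominator \<open>r\<close> turns the lowered exponent into a
    division by \<open>(root r x ^ r) ^ i\<close>, that is, by \<open>x ^ i\<close>.\<close>
  then have "q - real i = of_int (p - int (r * i)) / real r"
    using pr by (simp add: field_simps)
  then have "real_pow x (q - real i) = root r x powi (p - int (r * i))"
    using real_pow_fraction[OF pr(1), of x "p - int (r * i)"] x by simp
  also have "\<dots> = root r x powi p / (root r x ^ r) ^ i"
    using x \<open>r > 0\<close>
    by (subst power_int_diff) (simp_all add: power_int_of_nat power_mult del: of_nat_mult)
  also have "\<dots> = real_pow x q / x ^ i"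
    using real_pow_fraction[OF pr(1), of x p] pr x by (simp add: odd_real_root_pow)
  finally show ?thesis .
qed

text \<open>The positive factor \<open>w powr (1 / q)\<close> leaves \<open>x\<close> on its side of
  0, so the chosen branch of the inverse returns exactly this preimage.\<close>

lemma pow_inverse_real_pow_mult:
  assumes "real_pow_defined \<alpha> q" "q \<noteq> 0" "0 < \<alpha> * x" "0 < w"
  shows "pow_inverse \<alpha> q (real_pow x q * w) = x * w powr (1 / q)"
proof -
  have "real_pow (x * w powr (1 / q)) q = real_pow x q * w"
    using real_pow_mult_pos[OF real_pow_defined_same_sign[OF assms(1,3)], of "w powr (1 / q)"] assms
    by (simp add: powr_powr)
  moreover have "0 < \<alpha> * (x * w powr (1 / q))"
    using assms by (simp flip: mult.assoc)
  ultimately show ?thesis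
    using pow_inverse_real_pow[OF assms(1,2)] by metis
qed

section \<open>The truncated binomial series of \<open>(1 + z)^q\<close> as a polynomial\<close>

definition binomial_poly :: "real \<Rightarrow> nat \<Rightarrow> real poly" where
  "binomial_poly q N = (\<Sum>i=0..N. monom (q gchoose i) i)"

lemma poly_binomial_poly: "poly (binomial_poly q N) z = (\<Sum>i=0..N. (q gchoose i) * z ^ i)"
  by (simp add: binomial_poly_def poly_sum poly_monom)

lemma coeff_binomial_poly: "coeff (binomial_poly q N) i = (if i \<le> N then q gchoose i else 0)"
  by (simp add: binomial_poly_def coeff_sum)

text \<open>Since \<open>x^(q - i) = x^q / x^i\<close>, every summand contains the factor
  \<open>x^q\<close>. The cofactor is a polynomial in \<open>- (u x / x)\<close>; its positivity
  allows the \<open>q\<close>-th root to be taken factor by factor.\<close>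

lemma binomial_newton_map_factored:
  fixes f :: "real \<Rightarrow> real"
  defines "u \<equiv> \<lambda>x. f x / deriv f x"
  assumes "real_pow_defined \<alpha> q" "q \<noteq> 0" "0 < \<alpha> * x"
    and pos: "0 < poly (binomial_poly q N) (- (u x / x))"
  shows "binomial_newton_map f \<alpha> q N x = x * poly (binomial_poly q N) (- (u x / x)) powr (1 / q)"
proof -
  have "(q gchoose i) * real_pow x (q - real i) * (- u x) ^ i =
      real_pow x q * ((q gchoose i) * (- (u x / x)) ^ i)" for i
    using real_pow_diff_nat[OF real_pow_defined_same_sign[OF assms(2,4)], of i]
    by (simp add: power_divide minus_divide_left del: minus_divide_left[symmetric])
  then have "(\<Sum>i=0..N. (q gchoose i) * real_pow x (q - real i) * (- u x) ^ i) =
      real_pow x q * poly (binomial_poly q N) (- (u x / x))"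
    by (simp only: poly_binomial_poly sum_distrib_left)
  then show ?thesis
    using pow_inverse_real_pow_mult[OF assms(2-4) pos]
    by (simp add: binomial_newton_map_def u_def)
qed

text \<open>Near 0 the polynomial is positive, so its power has the explicit derivative
  \<open>G'\<close>, which is itself differentiable at 0; the remainder lemma then applies. Only the
  existence of \<open>c\<close> is recorded, because the comparison is with the error constant
  0.\<close>

lemma poly_powr_remainder_tendsto:
  fixes p :: "real poly"
  assumes "coeff p 0 = 1"
  shows "\<exists>c. ((\<lambda>z. (poly p z powr r - 1 - r * coeff p 1 * z) / z\<^sup>2) \<longlongrightarrow> c) (at 0)"
proof -
  define G' where "G' z = r * poly p z powr (r - 1) * poly (pderiv p) z" for z
  have p0: "poly p 0 = 1" using assms by (simp add: poly_0_coeff_0)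
  have p1: "poly (pderiv p) 0 = coeff p 1" by (simp add: poly_0_coeff_0 coeff_pderiv)
  have "isCont (poly p) 0" by simp
  then have "(poly p \<longlongrightarrow> 1) (nhds 0)"
    using p0 tendsto_at_iff_tendsto_nhds[of "poly p" 0] by (simp add: isCont_def)
  then have "\<forall>\<^sub>F z in nhds 0. 0 < poly p z"
    by (rule order_tendstoD) simp
  then have G: "\<forall>\<^sub>F z in nhds 0. ((\<lambda>z. poly p z powr r) has_real_derivative G' z) (at z)"
  proof eventually_elim
    case (elim z)
    show ?case unfolding G'_def
      using DERIV_fun_powr[OF poly_DERIV elim, of r] by simp
  qed
  have "((\<lambda>z. poly p z powr (r - 1)) has_real_derivative
      (r - 1) * poly p 0 powr (r - 1 - 1) * poly (pderiv p) 0) (at 0)"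
    using DERIV_fun_powr[OF poly_DERIV, of p 0 "r - 1"] p0 by simp
  from DERIV_mult[OF DERIV_cmult[OF this, of r] poly_DERIV[of "pderiv p" 0]]
  obtain D where "(G' has_real_derivative D) (at 0)"
    unfolding G'_def by blast
  from second_order_remainder_tendsto[OF G this] show ?thesis
    by (auto simp: p0 p1 G'_def)
qed

section \<open>Error constants of both methods at a simple root\<close>

context
  fixes f :: "real \<Rightarrow> real" and \<alpha> :: real
  assumes C2: "C2_near f \<alpha>" and root: "f \<alpha> = 0" and simple: "deriv f \<alpha> \<noteq> 0"
begin

text \<open>As \<open>f \<alpha> = 0\<close>, the Newton error times \<open>f' x\<close> equals
  \<open>(f' x - f' \<alpha>) (x - \<alpha>)\<close> minus the Taylor remainder of \<open>f\<close>.
  After division by \<open>(x - \<alpha>)^2\<close> the two parts tend to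
  \<open>f'' \<alpha>\<close> and \<open>f'' \<alpha> / 2\<close>.\<close>

lemma newton_map_error_tendsto:
  "((\<lambda>x. (newton_map f x - \<alpha>) / (x - \<alpha>)\<^sup>2) \<longlongrightarrow> deriv (deriv f) \<alpha> / (2 * deriv f \<alpha>)) (at \<alpha>)"
proof -
  obtain U where U: "open U" "\<alpha> \<in> U"
    and diff: "\<And>x. x \<in> U \<Longrightarrow> f field_differentiable (at x)"
      "\<And>x. x \<in> U \<Longrightarrow> deriv f field_differentiable (at x)"
    using C2 by (auto simp: C2_near_def)
  have "\<forall>\<^sub>F x in nhds \<alpha>. x \<in> U" using U by (rule eventually_nhds_in_open)
  then have f: "\<forall>\<^sub>F x in nhds \<alpha>. (f has_real_derivative deriv f x) (at x)"
    by eventually_elim (simp add: diff DERIV_deriv_iff_field_differentiable)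
  have f': "(deriv f has_real_derivative deriv (deriv f) \<alpha>) (at \<alpha>)"
    using diff(2) U by (simp add: DERIV_deriv_iff_field_differentiable)
  have f'_lim: "(deriv f \<longlongrightarrow> deriv f \<alpha>) (at \<alpha>)"
    using DERIV_isCont[OF f'] by (simp add: isCont_def)
  have "((\<lambda>x. ((deriv f x - deriv f \<alpha>) / (x - \<alpha>) -
        (f x - f \<alpha> - deriv f \<alpha> * (x - \<alpha>)) / (x - \<alpha>)\<^sup>2) / deriv f x)
      \<longlongrightarrow> (deriv (deriv f) \<alpha> - deriv (deriv f) \<alpha> / 2) / deriv f \<alpha>) (at \<alpha>)"
    using f' simple
    by (intro tendsto_divide[OF tendsto_diff] second_order_remainder_tendsto[OF f f'] f'_lim)
      (simp_all add: has_field_derivative_iff)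
  then have "((\<lambda>x. ((deriv f x - deriv f \<alpha>) / (x - \<alpha>) -
        (f x - f \<alpha> - deriv f \<alpha> * (x - \<alpha>)) / (x - \<alpha>)\<^sup>2) / deriv f x)
      \<longlongrightarrow> deriv (deriv f) \<alpha> / (2 * deriv f \<alpha>)) (at \<alpha>)"
    using simple by (simp add: field_simps)
  moreover have "\<forall>\<^sub>F x in at \<alpha>. x \<noteq> \<alpha>" by (simp add: eventually_at_filter)
  then have "\<forall>\<^sub>F x in at \<alpha>. ((deriv f x - deriv f \<alpha>) / (x - \<alpha>) -
        (f x - f \<alpha> - deriv f \<alpha> * (x - \<alpha>)) / (x - \<alpha>)\<^sup>2) / deriv f x =
      (newton_map f x - \<alpha>) / (x - \<alpha>)\<^sup>2"
    using tendsto_imp_eventually_ne[OF f'_lim simple]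
  proof eventually_elim
    case (elim x)
    then have "x - \<alpha> \<noteq> 0" by simp
    with elim(2) show ?case
      by (simp add: newton_map_def root divide_simps) (simp add: algebra_simps power2_eq_square)
  qed
  ultimately show ?thesis by (rule Lim_transform_eventually)
qed

lemma newton_map_asymptotic_error_constant:
  "has_asymptotic_error_constant (newton_map f) \<alpha> \<bar>deriv (deriv f) \<alpha> / (2 * deriv f \<alpha>)\<bar>"
  using tendsto_rabs[OF newton_map_error_tendsto]
  by (simp add: has_asymptotic_error_constant_def abs_divide)

text \<open>The ratio is 1 minus a quadratic error divided by \<open>x - \<alpha>\<close>. It allows
  the Newton correction to be replaced by \<open>x - \<alpha>\<close> in second-order terms and
  shows that it is nonzero near \<alpha>.\<close>

lemma newton_step_ratio_tendsto: "((\<lambda>x. f x / deriv f x / (x - \<alpha>)) \<longlongrightarrow> 1) (at \<alpha>)"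
proof (rule Lim_transform_eventually)
  have "((\<lambda>x. 1 - (newton_map f x - \<alpha>) / (x - \<alpha>)\<^sup>2 * (x - \<alpha>)) \<longlongrightarrow>
      1 - deriv (deriv f) \<alpha> / (2 * deriv f \<alpha>) * (\<alpha> - \<alpha>)) (at \<alpha>)"
    by (intro tendsto_intros newton_map_error_tendsto)
  then show "((\<lambda>x. 1 - (newton_map f x - \<alpha>) / (x - \<alpha>)\<^sup>2 * (x - \<alpha>)) \<longlongrightarrow> 1) (at \<alpha>)" by simp
  have "1 - (newton_map f x - \<alpha>) / (x - \<alpha>)\<^sup>2 * (x - \<alpha>) = f x / deriv f x / (x - \<alpha>)"
    if "x \<noteq> \<alpha>" for x
  proof -
    have e: "x - \<alpha> \<noteq> 0" using that by simp
    have "1 - (x - u - \<alpha>) / (x - \<alpha>)\<^sup>2 * (x - \<alpha>) = u / (x - \<alpha>)" for u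
      using e by (simp add: divide_simps) (simp add: algebra_simps power2_eq_square)
    then show ?thesis by (simp add: newton_map_def)
  qed
  then show "\<forall>\<^sub>F x in at \<alpha>. 1 - (newton_map f x - \<alpha>) / (x - \<alpha>)\<^sup>2 * (x - \<alpha>) = f x / deriv f x / (x - \<alpha>)"
    by (simp add: eventually_at_filter)
qed

lemma binomial_newton_map_asymptotic_error_constant:
  assumes "\<alpha> \<noteq> 0" "q \<noteq> 0" "real_pow_defined \<alpha> q" "N \<ge> 1"
  shows "\<exists>B. has_asymptotic_error_constant (binomial_newton_map f \<alpha> q N) \<alpha> B"
proof -
  define u where "u x = f x / deriv f x" for x
  define z where "z x = - (u x / x)" for x
  define P where "P = poly (binomial_poly q N)"
  define E where "E z = (P z powr (1 / q) - 1 - z) / z\<^sup>2" for z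
  have ratio: "((\<lambda>x. u x / (x - \<alpha>)) \<longlongrightarrow> 1) (at \<alpha>)"
    using newton_step_ratio_tendsto by (simp add: u_def)
  have "((\<lambda>x. - (u x / (x - \<alpha>) * (x - \<alpha>) / x)) \<longlongrightarrow> - (1 * (\<alpha> - \<alpha>) / \<alpha>)) (at \<alpha>)"
    using assms by (intro tendsto_intros ratio) auto
  then have "((\<lambda>x. - (u x / (x - \<alpha>) * (x - \<alpha>) / x)) \<longlongrightarrow> 0) (at \<alpha>)" by simp
  then have z_lim: "(z \<longlongrightarrow> 0) (at \<alpha>)"
    by (rule Lim_transform_eventually) (simp add: eventually_at_filter z_def)
  have u_ne: "\<forall>\<^sub>F x in at \<alpha>. u x / (x - \<alpha>) \<noteq> 0"
    by (rule tendsto_imp_eventually_ne[OF ratio]) simp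
  \<comment> \<open>The limit of \<open>E\<close> at 0 ignores the point 0 itself, so composing it
    with \<open>z\<close> requires \<open>z\<close> to avoid 0.\<close>
  have "\<forall>\<^sub>F x in at \<alpha>. z x \<noteq> 0"
    using u_ne eventually_same_sign[OF assms(1)] by eventually_elim (auto simp: z_def)
  with z_lim have z_at: "filterlim z (at 0) (at \<alpha>)" by (simp add: filterlim_at)
  \<comment> \<open>Here \<open>N \<ge> 1\<close> enters: the linear coefficient \<open>q\<close>
    cancels against the exponent \<open>1 / q\<close>, leaving \<open>z\<close> as the linear term,
    which is the Newton correction.\<close>
  have "coeff (binomial_poly q N) 0 = 1" "coeff (binomial_poly q N) 1 = q"
    using assms(4) by (simp_all add: coeff_binomial_poly)
  with poly_powr_remainder_tendsto[of "binomial_poly q N" "1 / q"] obtain c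
    where "(E \<longlongrightarrow> c) (at 0)"
    using assms(2) by (auto simp: E_def[abs_def] P_def)
  then have E_lim: "((\<lambda>x. E (z x)) \<longlongrightarrow> c) (at \<alpha>)"
    using z_at by (rule filterlim_compose)
  have "((\<lambda>x. P (z x)) \<longlongrightarrow> P 0) (at \<alpha>)"
    unfolding P_def by (intro tendsto_intros z_lim)
  moreover have "P 0 = 1" by (simp add: P_def poly_0_coeff_0 coeff_binomial_poly)
  ultimately have P_pos: "\<forall>\<^sub>F x in at \<alpha>. 0 < P (z x)"
    by (intro order_tendstoD) auto
  \<comment> \<open>With the remainder kept exactly as \<open>E\<close>,
    \<open>x (1 + z + z^2 E)\<close> is \<open>x - u + (u^2 / x) E\<close>, so this is an identity
    whose terms all have known limits.\<close>
  have "\<forall>\<^sub>F x in at \<alpha>. (newton_map f x - \<alpha>) / (x - \<alpha>)\<^sup>2 + (u x / (x - \<alpha>))\<^sup>2 / x * E (z x) =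
      (binomial_newton_map f \<alpha> q N x - \<alpha>) / (x - \<alpha>)\<^sup>2"
    using P_pos u_ne eventually_same_sign[OF assms(1)]
  proof eventually_elim
    case (elim x)
    have ne: "x \<noteq> 0" "z x \<noteq> 0" using elim by (auto simp: z_def)
    have "binomial_newton_map f \<alpha> q N x = x * P (z x) powr (1 / q)"
      using binomial_newton_map_factored[of \<alpha> q x N f] assms elim
      by (simp add: P_def z_def u_def)
    also have "P (z x) powr (1 / q) = 1 + z x + (z x)\<^sup>2 * E (z x)"
      using ne by (simp add: E_def)
    also have "x * \<dots> = newton_map f x + (u x)\<^sup>2 / x * E (z x)"
      using ne(1) by (simp add: newton_map_def z_def flip: u_def)
        (simp add: field_simps power2_eq_square)
    finally show ?case by (simp add: power_divide diff_divide_distrib add_divide_distrib)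
  qed
  moreover have "((\<lambda>x. (newton_map f x - \<alpha>) / (x - \<alpha>)\<^sup>2 + (u x / (x - \<alpha>))\<^sup>2 / x * E (z x))
      \<longlongrightarrow> deriv (deriv f) \<alpha> / (2 * deriv f \<alpha>) + 1\<^sup>2 / \<alpha> * c) (at \<alpha>)"
    using assms(1) by (intro tendsto_intros newton_map_error_tendsto ratio E_lim)
  ultimately have "((\<lambda>x. (binomial_newton_map f \<alpha> q N x - \<alpha>) / (x - \<alpha>)\<^sup>2)
      \<longlongrightarrow> deriv (deriv f) \<alpha> / (2 * deriv f \<alpha>) + 1\<^sup>2 / \<alpha> * c) (at \<alpha>)"
    by (rule Lim_transform_eventually[rotated])
  from tendsto_rabs[OF this] show ?thesis
    by (auto simp: has_asymptotic_error_constant_def abs_divide)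
qed

text \<open>The error constant does not determine the value at \<alpha>. There the Newton correction
  vanishes and the polynomial factor is 1.\<close>

lemma binomial_newton_map_root:
  assumes "\<alpha> \<noteq> 0" "q \<noteq> 0" "real_pow_defined \<alpha> q"
  shows "binomial_newton_map f \<alpha> q N \<alpha> = \<alpha>"
proof -
  have "0 < \<alpha> * \<alpha>" using assms(1) by (metis not_real_square_gt_zero)
  moreover have "poly (binomial_poly q N) 0 = 1"
    by (simp add: poly_0_coeff_0 coeff_binomial_poly)
  ultimately show ?thesis
    using binomial_newton_map_factored[OF assms(3,2), of \<alpha> N f] by (simp add: root)
qed

end

section \<open>Comparison of the two methods\<close>

lemma has_asymptotic_error_constant_nonneg:
  assumes "has_asymptotic_error_constant \<phi> \<alpha> C"
  shows "0 \<le> C"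
  using assms unfolding has_asymptotic_error_constant_def
  by (rule tendsto_lowerbound) auto

theorem theorem4p2:
  fixes f :: "real \<Rightarrow> real" and \<alpha> q :: real
  assumes "C2_near f \<alpha>"
    and "\<alpha> \<noteq> 0"
    and "f \<alpha> = 0" and "deriv f \<alpha> \<noteq> 0"
    and "deriv (deriv f) \<alpha> = 0"
    and "q \<noteq> 0" and "q \<noteq> 1"
    and "real_pow_defined \<alpha> q"
  shows "(\<bar>curvature f \<alpha>\<bar> = 0 \<and> 0 \<le> \<bar>curvature (pow_transform f \<alpha> q) (real_pow \<alpha> q)\<bar>) \<and>
    (\<forall>N\<ge>1.
      (\<bar>curvature f \<alpha>\<bar> = 0 \<and> 0 \<le> \<bar>curvature (pow_transform f \<alpha> q) (real_pow \<alpha> q)\<bar>) \<longleftrightarrow>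
      converges_equal_or_faster (newton_map f) (binomial_newton_map f \<alpha> q N) \<alpha>)"
proof (intro conjI allI impI iffI)
  show curv: "\<bar>curvature f \<alpha>\<bar> = 0"
    using assms(5) by (simp add: curvature_def)
  fix N :: nat
  assume "N \<ge> 1"
  then obtain B where B: "has_asymptotic_error_constant (binomial_newton_map f \<alpha> q N) \<alpha> B"
    using binomial_newton_map_asymptotic_error_constant assms by metis
  have A: "has_asymptotic_error_constant (newton_map f) \<alpha> 0"
    using newton_map_asymptotic_error_constant[OF assms(1,3,4)] assms(5) by simp
  have "locally_convergent (newton_map f) \<alpha>"
    by (rule locally_convergent_if_asymptotic_error_constant[OF _ A])
      (simp add: newton_map_def assms(3))
  moreover have "locally_convergent (binomial_newton_map f \<alpha> q N) \<alpha>"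
    by (rule locally_convergent_if_asymptotic_error_constant[OF _ B])
      (use binomial_newton_map_root assms in metis)
  \<comment> \<open>With Newton's constant equal to 0, the inequality between the constants is the
    nonnegativity of \<open>B\<close>.\<close>
  ultimately show "converges_equal_or_faster (newton_map f) (binomial_newton_map f \<alpha> q N) \<alpha>"
    using A B has_asymptotic_error_constant_nonneg[OF B]
    by (auto simp: converges_equal_or_faster_def)
\<comment> \<open>What remains is the nonnegativity of an absolute value and the converse
  implication, whose conclusion is again the curvature statement.\<close>
qed (simp_all add: curvature_def assms(5))

end
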